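(* For every integer $n\ge 1$ one has $a(n)\le 2$. That is, for $n$ coins weighing $1,2,\ldots,n$ grams, there is always a sequence of at most two weighings on a balance scale that determines the weight of at least one of the coins.
   Context: There are $n$ coins weighing $1,2,\ldots,n$ grams (one of each weight). Identify each coin with its true weight, so the coins are the elements of $\{1,\ldots,n\}$. Baron M\"unchhausen knows all the weights; the audience knows only that the weights are $1,\ldots,n$ in some order. A weighing on a balance scale is an ordered pair $(L,R)$ of disjoint nonempty subsets of $\{1,\ldots,n\}$ (the coins in the left and right cups); its outcome is whether $\sum_{x\in L}x$ is less than, equal to, or greater than $\sum_{x\in R}x$. The audience can tell the coins apart and track them across weighings, and sees the outcomes. A sequence of weighings $(L_1,R_1),\ldots,(L_m,R_m)$ determines (demonstrates) the weight of coin $k$ if every permutation $\sigma$ of $\{1,\ldots,n\}$ that is consistent with all the outcomes (i.e. for each $r$, $\sum_{x\in L_r}\sigma(x)-\sum_{x\in R_r}\sigma(x)$ has the same sign, negative, zero or positive, as $\sum_{x\in L_r}x-\sum_{x\in R_r}x$) satisfies $\sigma(k)=k$. Baron M\"unchhausen's sequence $a(n)$ is the minimum number $m\ge 0$ of weighings in a sequence that determines the weight of at least one coin. *)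

theory Defs
  imports "HOL-Combinatorics.Permutations"
begin

text \<open>Coins are identified with their true weights, so the coins are the elements of
  \<open>{1..n}\<close>. A weighing is the pair (left cup, right cup).\<close>

type_synonym weighing = "nat set \<times> nat set"

definition weighings :: "nat \<Rightarrow> weighing set" where
  "weighings n = {(L, R). L \<subseteq> {1..n} \<and> R \<subseteq> {1..n} \<and> L \<noteq> {} \<and> R \<noteq> {} \<and> L \<inter> R = {}}"

text \<open>The outcome of a weighing when coin \<open>x\<close> weighs \<open>\<sigma> x\<close>: the value is
  \<open>-1\<close>, \<open>0\<close> or \<open>1\<close> according to whether the left cup is lighter than, as heavy as,
  or heavier than the right cup. The actual outcome is the case \<open>\<sigma> = id\<close>.\<close>

definition outcome :: "(nat \<Rightarrow> nat) \<Rightarrow> weighing \<Rightarrow> int" where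
  "outcome \<sigma> w = sgn (int (\<Sum>x\<in>fst w. \<sigma> x) - int (\<Sum>x\<in>snd w. \<sigma> x))"

definition consistent :: "weighing list \<Rightarrow> (nat \<Rightarrow> nat) \<Rightarrow> bool" where
  "consistent ws \<sigma> \<longleftrightarrow> (\<forall>w\<in>set ws. outcome \<sigma> w = outcome id w)"

definition determines :: "nat \<Rightarrow> weighing list \<Rightarrow> nat \<Rightarrow> bool" where
  "determines n ws k \<longleftrightarrow> (\<forall>\<sigma>. \<sigma> permutes {1..n} \<and> consistent ws \<sigma> \<longrightarrow> \<sigma> k = k)"

definition determines_some_coin :: "nat \<Rightarrow> weighing list \<Rightarrow> bool" where
  "determines_some_coin n ws \<longleftrightarrow> (\<exists>k\<in>{1..n}. determines n ws k)"

text \<open>\<open>LEAST\<close> carries information only if some sequence of weighings determines a coin;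
  a bound on \<open>baron n\<close> should therefore be accompanied by such a sequence.\<close>

definition baron :: "nat \<Rightarrow> nat" where
  "baron n = (LEAST m. \<exists>ws. length ws = m \<and> set ws \<subseteq> weighings n \<and> determines_some_coin n ws)"

end

theory Submission
  imports Defs "HOL-Computational_Algebra.Primes"
begin

text \<open>
  Write \<open>T t = 1 + \<dots> + t\<close>, called \<open>tri t\<close> below. Two weighings that come out
  balanced can pin down the heaviest coin \<open>n\<close>. Suppose \<open>a \<le> b \<le> m \<le> c \<le> d < n\<close> satisfy
  \<open>T a + T b + T c + T d = T n + n\<close>, and some nonempty set \<open>P\<close> of coins strictly between
  \<open>d\<close> and \<open>n\<close> satisfies \<open>\<Sum>P + n = T m\<close>. Weigh \<open>{1..m}\<close> against \<open>P \<union> {n}\<close>, and then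
  \<open>{1..a} \<union> {m+1..c} \<union> P\<close> against \<open>{b+1..m} \<union> ({d+1..n-1} - P)\<close>. If a permutation
  \<open>\<sigma>\<close> balances both and \<open>S t\<close> is the sum of \<open>\<sigma>\<close> over \<open>{1..t}\<close>, then twice the first
  equation plus the second reads \<open>S a + S b + S c + S d = T n + \<sigma> n\<close>. Each sum \<open>S t\<close> of \<open>t\<close>
  distinct positive numbers is at least \<open>T t\<close>, so \<open>\<sigma> n \<ge> n\<close>, and hence \<open>\<sigma> n = n\<close>. The same
  computation with \<open>\<sigma> = id\<close> shows that the actual weights balance (lemma \<open>two_weighings\<close>).

  It remains to find such numbers. In terms of \<open>2 t + 1\<close>, the condition on the four triangular numbers
  asks for four odd squares with sum \<open>4 (n\<^sup>2 + 3 n + 1)\<close>. Lagrange's theorem writes the odd number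
  \<open>n\<^sup>2 + 3 n + 1\<close> as \<open>w\<^sup>2 + x\<^sup>2 + y\<^sup>2 + z\<^sup>2\<close> with \<open>w \<ge> x \<ge> y \<ge> z \<ge> 0\<close>, and the four numbers
  \<open>w \<plusminus> x \<plusminus> y \<plusminus> z\<close> with an odd number of minus signs are odd and have the right sum of
  squares. The largest of them is \<open>w + x + y - z\<close>, whose square is at most three quarters of the total.
  This keeps \<open>d\<close> below about \<open>0.87 n\<close>, so that a long interval \<open>{d+1..n-1}\<close> remains and
  \<open>c\<close> has order \<open>n\<close>.

  The set \<open>P\<close> then comes from the fact that the \<open>k\<close>-element subsets of an interval take every
  sum between the smallest and the largest one; for \<open>n \<ge> 300\<close> the interval is long enough for the
  ranges of consecutive \<open>k\<close> to overlap, and a suitable \<open>m\<close> between \<open>b\<close> and \<open>c\<close>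
  gives a target sum in their union (lemma \<open>large_certificate\<close>). For \<open>11 \<le> n < 300\<close> and
  \<open>n = 8\<close> explicit values are listed; the other \<open>n\<close> get weighings of their own.
\<close>

section \<open>Lagrange's four-square theorem\<close>

definition four_squares :: "int \<Rightarrow> bool" where
  "four_squares n \<longleftrightarrow> (\<exists>a b c d. n = a\<^sup>2 + b\<^sup>2 + c\<^sup>2 + d\<^sup>2)"

lemma euler_four_squares:
  fixes a b c d x y z w :: int
  shows "(a\<^sup>2 + b\<^sup>2 + c\<^sup>2 + d\<^sup>2) * (x\<^sup>2 + y\<^sup>2 + z\<^sup>2 + w\<^sup>2) =
    (a * x + b * y + c * z + d * w)\<^sup>2 + (a * y - b * x + c * w - d * z)\<^sup>2
    + (a * z - c * x + d * y - b * w)\<^sup>2 + (a * w - d * x + b * z - c * y)\<^sup>2"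
  by (simp add: power2_eq_square algebra_simps)

lemma four_squares_mult:
  assumes "four_squares m" "four_squares n"
  shows "four_squares (m * n)"
  using assms euler_four_squares unfolding four_squares_def by metis

lemma symmetric_residue:
  fixes a m :: int
  assumes "0 < m"
  obtains y k where "a = y + m * k" "\<bar>2 * y\<bar> \<le> m"
proof -
  define k where "k = (2 * a + m) div (2 * m)"
  define r where "r = (2 * a + m) mod (2 * m)"
  have "2 * a + m = 2 * m * k + r" unfolding k_def r_def by simp
  moreover have "0 \<le> r" "r < 2 * m" using assms unfolding r_def by simp_all
  ultimately have "\<bar>2 * (a - m * k)\<bar> \<le> m" by (simp add: algebra_simps)
  then show thesis using that[of "a - m * k" k] by simp
qed

lemma square_bound_of_abs:
  fixes y m :: int
  assumes "\<bar>2 * y\<bar> \<le> m"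
  shows "4 * y\<^sup>2 \<le> m\<^sup>2"
proof -
  have "(2 * y)\<^sup>2 \<le> m\<^sup>2" using assms by (metis abs_le_square_iff abs_of_nonneg abs_ge_zero order_trans)
  then show ?thesis by (simp add: power_mult_distrib)
qed

text \<open>
  Descent step of Lagrange's proof: the given representation of \<open>m p\<close>, multiplied by the one of
  \<open>m m'\<close> that comes from the residues of least absolute value modulo \<open>m\<close>, is a sum of four
  squares all divisible by \<open>m\<^sup>2\<close>. If all residues are \<open>0\<close> or all have absolute value
  \<open>m / 2\<close> (the cases \<open>m' = 0\<close> and \<open>m' = m\<close>), then \<open>m\<close> would divide \<open>p\<close>. Treating
  the second case in this way avoids a separate argument for even \<open>m\<close>.
\<close>

lemma four_squares_descent:
  fixes p m :: int
  assumes p: "prime p" and m: "1 < m" "m < p" and fs: "four_squares (m * p)"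
  shows "\<exists>m'. 1 \<le> m' \<and> m' < m \<and> four_squares (m' * p)"
proof -
  have ndvd: "\<not> m dvd p" using p m by (metis abs_of_nonneg less_le not_less prime_int_iff zero_le_one order_trans)
  obtain a b c d where abcd: "m * p = a\<^sup>2 + b\<^sup>2 + c\<^sup>2 + d\<^sup>2"
    using fs unfolding four_squares_def by blast
  obtain x i where x: "a = x + m * i" "\<bar>2 * x\<bar> \<le> m" using symmetric_residue m by (metis less_trans zero_less_one)
  obtain y j where y: "b = y + m * j" "\<bar>2 * y\<bar> \<le> m" using symmetric_residue m by (metis less_trans zero_less_one)
  obtain z k where z: "c = z + m * k" "\<bar>2 * z\<bar> \<le> m" using symmetric_residue m by (metis less_trans zero_less_one)
  obtain w l where w: "d = w + m * l" "\<bar>2 * w\<bar> \<le> m" using symmetric_residue m by (metis less_trans zero_less_one)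
  define m' where "m' = p - 2 * (x * i + y * j + z * k + w * l) - m * (i\<^sup>2 + j\<^sup>2 + k\<^sup>2 + l\<^sup>2)"
  \<comment> \<open>\<open>m'\<close> is the sum of the squares of the residues, divided by \<open>m\<close>.\<close>
  have S: "x\<^sup>2 + y\<^sup>2 + z\<^sup>2 + w\<^sup>2 = m * m'"
    using abcd unfolding m'_def x(1) y(1) z(1) w(1)
    by (simp add: power2_eq_square algebra_simps)
  note bounds = square_bound_of_abs[OF x(2)] square_bound_of_abs[OF y(2)]
    square_bound_of_abs[OF z(2)] square_bound_of_abs[OF w(2)]
  have "m * m' \<le> m * m" using bounds S by (simp add: power2_eq_square)
  then have le: "m' \<le> m" using m by simp
  have "0 \<le> m * m'" using S by (metis add_nonneg_nonneg zero_le_power2)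
  then have ge: "0 \<le> m'" using m by (simp add: zero_le_mult_iff)
  have "m' \<noteq> 0"
  proof
    assume "m' = 0"
    then have "x\<^sup>2 + y\<^sup>2 + z\<^sup>2 + w\<^sup>2 = 0" using S by simp
    then have "x = 0 \<and> y = 0 \<and> z = 0 \<and> w = 0"
      by (smt (verit) zero_le_power2 zero_eq_power2)
    then have "m * p = m * (m * (i\<^sup>2 + j\<^sup>2 + k\<^sup>2 + l\<^sup>2))"
      using abcd x(1) y(1) z(1) w(1) by (simp add: power2_eq_square algebra_simps)
    then show False using ndvd m by auto
  qed
  moreover have "m' \<noteq> m"
  proof
    assume "m' = m"
    then have "4 * x\<^sup>2 = m\<^sup>2 \<and> 4 * y\<^sup>2 = m\<^sup>2 \<and> 4 * z\<^sup>2 = m\<^sup>2 \<and> 4 * w\<^sup>2 = m\<^sup>2"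
      using bounds S by (simp add: power2_eq_square)
    then have "(2 * x)\<^sup>2 = m\<^sup>2" "(2 * y)\<^sup>2 = m\<^sup>2" "(2 * z)\<^sup>2 = m\<^sup>2" "(2 * w)\<^sup>2 = m\<^sup>2"
      by (simp_all add: power_mult_distrib)
    then have dv: "m dvd 2 * x" "m dvd 2 * y" "m dvd 2 * z" "m dvd 2 * w"
      by (metis dvd_refl pow_divides_pow_iff zero_less_numeral)+
    have "p = m' + i * (2 * x) + j * (2 * y) + k * (2 * z) + l * (2 * w) + m * (i\<^sup>2 + j\<^sup>2 + k\<^sup>2 + l\<^sup>2)"
      unfolding m'_def by (simp add: algebra_simps)
    moreover have "m dvd m' + i * (2 * x) + j * (2 * y) + k * (2 * z) + l * (2 * w) + m * (i\<^sup>2 + j\<^sup>2 + k\<^sup>2 + l\<^sup>2)"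
      by (intro dvd_add dvd_mult dvd_triv_left dv) (simp add: \<open>m' = m\<close>)
    ultimately show False using ndvd by simp
  qed
  moreover have "four_squares (m' * p)"
  proof -
    have scale: "(m * r)\<^sup>2 + (m * s)\<^sup>2 + (m * t)\<^sup>2 + (m * u)\<^sup>2
        = m * (m * (r\<^sup>2 + s\<^sup>2 + t\<^sup>2 + u\<^sup>2))" for r s t u
      by (simp add: power2_eq_square algebra_simps)
    have "m * (m * (m' * p)) = (m * p) * (m * m')" by simp
    also have "\<dots> = (a * x + b * y + c * z + d * w)\<^sup>2 + (a * y - b * x + c * w - d * z)\<^sup>2
        + (a * z - c * x + d * y - b * w)\<^sup>2 + (a * w - d * x + b * z - c * y)\<^sup>2"
      unfolding abcd S[symmetric] by (rule euler_four_squares)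
    also have "a * x + b * y + c * z + d * w = m * (m' + i * x + j * y + k * z + l * w)"
      unfolding x(1) y(1) z(1) w(1) using S by (simp add: power2_eq_square algebra_simps)
    also have "a * y - b * x + c * w - d * z = m * (i * y - j * x + k * w - l * z)"
      unfolding x(1) y(1) z(1) w(1) by (simp add: algebra_simps)
    also have "a * z - c * x + d * y - b * w = m * (i * z - k * x + l * y - j * w)"
      unfolding x(1) y(1) z(1) w(1) by (simp add: algebra_simps)
    also have "a * w - d * x + b * z - c * y = m * (i * w - l * x + j * z - k * y)"
      unfolding x(1) y(1) z(1) w(1) by (simp add: algebra_simps)
    finally have "m * (m * (m' * p)) = m * (m * ((m' + i * x + j * y + k * z + l * w)\<^sup>2
        + (i * y - j * x + k * w - l * z)\<^sup>2 + (i * z - k * x + l * y - j * w)\<^sup>2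
        + (i * w - l * x + j * z - k * y)\<^sup>2))"
      using scale by simp
    then show ?thesis using m unfolding four_squares_def by auto
  qed
  ultimately show ?thesis using le ge by (intro exI[of _ m']) auto
qed

lemma inj_on_square_mod:
  fixes h p :: int
  assumes "prime p" "2 * h < p"
  shows "inj_on (\<lambda>x. x\<^sup>2 mod p) {0..h}"
proof (rule inj_onI)
  fix x y assume xy: "x \<in> {0..h}" "y \<in> {0..h}" "x\<^sup>2 mod p = y\<^sup>2 mod p"
  then have "p dvd x\<^sup>2 - y\<^sup>2" by (simp add: mod_eq_dvd_iff)
  then have "p dvd (x - y) * (x + y)" by (simp add: power2_eq_square algebra_simps)
  then have "p dvd x - y \<or> p dvd x + y" using assms(1) prime_dvd_mult_iff by blast
  then show "x = y"
  proof
    assume "p dvd x - y"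
    then show ?thesis using xy assms dvd_imp_le_int[of "x - y" p] by (cases "x = y") auto
  next
    assume "p dvd x + y"
    then show ?thesis using xy assms zdvd_imp_le[of p "x + y"] by (cases "x + y = 0") auto
  qed
qed

text \<open>
  Pigeonhole: with \<open>p = 2 h + 1\<close>, the \<open>h + 1\<close> residues \<open>x\<^sup>2\<close> and the \<open>h + 1\<close> residues
  \<open>- 1 - y\<^sup>2\<close> cannot be disjoint among \<open>p\<close> classes.
\<close>

lemma prime_dvd_two_squares_plus_one:
  fixes p :: int
  assumes p: "prime p" "odd p"
  shows "\<exists>x y. 0 \<le> x \<and> 2 * x < p \<and> 0 \<le> y \<and> 2 * y < p \<and> p dvd x\<^sup>2 + y\<^sup>2 + 1"
proof -
  obtain h where h: "p = 2 * h + 1" using p(2) by (elim oddE)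
  have "0 < p" using p(1) by (simp add: prime_gt_0_int)
  then have h0: "0 \<le> h" using h by simp
  define A where "A = (\<lambda>x. x\<^sup>2 mod p) ` {0..h}"
  define B where "B = (\<lambda>y. (- 1 - y\<^sup>2) mod p) ` {0..h}"
  have "card A = nat (h + 1)"
    unfolding A_def using inj_on_square_mod[OF p(1), of h] h by (simp add: card_image)
  moreover have "inj_on (\<lambda>y. (- 1 - y\<^sup>2) mod p) {0..h}"
  proof (rule inj_onI)
    fix x y assume xy: "x \<in> {0..h}" "y \<in> {0..h}" "(- 1 - x\<^sup>2) mod p = (- 1 - y\<^sup>2) mod p"
    then have "p dvd (- 1 - x\<^sup>2) - (- 1 - y\<^sup>2)" by (simp only: mod_eq_dvd_iff)
    then have "p dvd y\<^sup>2 - x\<^sup>2" by simp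
    then have "y\<^sup>2 mod p = x\<^sup>2 mod p" by (simp only: mod_eq_dvd_iff)
    then show "x = y"
      using inj_on_square_mod[OF p(1), of h] h xy(1,2) by (auto dest: inj_onD)
  qed
  then have "card B = nat (h + 1)" unfolding B_def by (simp add: card_image)
  moreover have sub: "A \<union> B \<subseteq> {0..<p}" unfolding A_def B_def using \<open>0 < p\<close> by auto
  then have "card (A \<union> B) \<le> nat p" using card_mono[OF _ sub] by simp
  moreover have "finite A" "finite B" unfolding A_def B_def by auto
  ultimately have "A \<inter> B \<noteq> {}" using h h0 card_Un_disjoint[of A B] by auto
  then obtain u where "u \<in> A" "u \<in> B" by blast
  then obtain x y where xy: "x \<in> {0..h}" "y \<in> {0..h}" "x\<^sup>2 mod p = (- 1 - y\<^sup>2) mod p"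
    unfolding A_def B_def image_iff by metis
  then have "p dvd x\<^sup>2 - (- 1 - y\<^sup>2)" by (simp only: mod_eq_dvd_iff)
  then have "p dvd x\<^sup>2 + y\<^sup>2 + 1" by (simp add: algebra_simps)
  then show ?thesis using xy h by (intro exI[of _ x] exI[of _ y]) auto
qed

lemma four_squares_prime:
  fixes p :: int
  assumes p: "prime p"
  shows "four_squares p"
proof (cases "even p")
  case True
  then have "p = 1\<^sup>2 + 1\<^sup>2 + 0\<^sup>2 + 0\<^sup>2" using p primes_dvd_imp_eq[of 2 p] by simp
  then show ?thesis unfolding four_squares_def by blast
next
  case False
  then obtain x y where xy: "0 \<le> x" "2 * x < p" "0 \<le> y" "2 * y < p" "p dvd x\<^sup>2 + y\<^sup>2 + 1"
    using prime_dvd_two_squares_plus_one[OF p] by blast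
  have p2: "2 \<le> p" using p by (rule prime_ge_2_int)
  obtain q where q: "x\<^sup>2 + y\<^sup>2 + 1 = p * q" using xy(5) by (elim dvdE)
  have "(2 * x)\<^sup>2 \<le> (p - 1)\<^sup>2" "(2 * y)\<^sup>2 \<le> (p - 1)\<^sup>2"
    using xy by (intro power_mono; simp)+
  then have "4 * (p * q) \<le> 2 * (p - 1)\<^sup>2 + 4"
    unfolding q[symmetric] power_mult_distrib by simp
  also have "\<dots> < 4 * (p * p)"
    using p2 mult_mono[of 2 p 2 p] by (simp add: power2_eq_square algebra_simps)
  finally have "p * q < p * p" by simp
  then have "q < p" using p2 by simp
  have "0 < p * q" unfolding q[symmetric] by (smt (verit) zero_le_power2)
  then have "1 \<le> q" using p2 by (simp add: zero_less_mult_iff)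
  have "q * p = x\<^sup>2 + y\<^sup>2 + 1\<^sup>2 + 0\<^sup>2" using q by (simp add: mult.commute)
  then have "four_squares (q * p)" unfolding four_squares_def by blast
  with \<open>1 \<le> q\<close> \<open>q < p\<close> show ?thesis
  proof (induction "nat q" arbitrary: q rule: less_induct)
    case less
    show ?case
    proof (cases "q = 1")
      case True
      then show ?thesis using less.prems by simp
    next
      case False
      then obtain q' where "1 \<le> q'" "q' < q" "four_squares (q' * p)"
        using four_squares_descent[OF p, of q] less.prems by auto
      then show ?thesis using less.hyps[of q'] less.prems by auto
    qed
  qed
qed

theorem lagrange_four_squares:
  fixes n :: nat
  shows "four_squares (int n)"
proof (induction n rule: prime_divisors_induct)
  case zero
  have "int 0 = 0\<^sup>2 + 0\<^sup>2 + 0\<^sup>2 + 0\<^sup>2" by simp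
  then show ?case unfolding four_squares_def by blast
next
  case (unit x)
  then have "int x = 1\<^sup>2 + 0\<^sup>2 + 0\<^sup>2 + 0\<^sup>2" by simp
  then show ?case unfolding four_squares_def by blast
next
  case (factor p x)
  then show ?case using four_squares_mult[OF four_squares_prime[of "int p"]] by simp
qed

lemma four_squares_sorted:
  fixes n :: nat
  obtains w x y z :: int where "int n = w\<^sup>2 + x\<^sup>2 + y\<^sup>2 + z\<^sup>2" "w \<ge> x" "x \<ge> y" "y \<ge> z" "z \<ge> 0"
proof -
  obtain a b c d where abcd: "int n = a\<^sup>2 + b\<^sup>2 + c\<^sup>2 + d\<^sup>2"
    using lagrange_four_squares[of n] unfolding four_squares_def by blast
  define s where "s = [\<bar>a\<bar>, \<bar>b\<bar>, \<bar>c\<bar>, \<bar>d\<bar>]"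
  obtain r where rs: "r = sort s" by blast
  then have "length r = 4" by (simp add: s_def)
  then obtain z y x w where "r = [z, y, x, w]"
    by (auto simp: numeral_eq_Suc length_Suc_conv)
  then have r: "sort s = [z, y, x, w]" using rs by simp
  have "sum_list (map (\<lambda>t. t\<^sup>2) (sort s)) = sum_list (map (\<lambda>t. t\<^sup>2) s)"
    by (metis mset_map mset_sort sum_mset_sum_list)
  then have "int n = w\<^sup>2 + x\<^sup>2 + y\<^sup>2 + z\<^sup>2" unfolding r abcd by (simp add: s_def)
  moreover have "sorted [z, y, x, w]" unfolding r[symmetric] by (rule sorted_sort)
  moreover have "z \<in> set (sort s)" unfolding r by simp
  then have "z \<in> set s" by (simp only: set_sort)
  then have "z \<ge> 0" unfolding s_def by auto
  ultimately show thesis by (intro that[of w x y z]) auto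
qed

section \<open>Triangular numbers and permuted weights\<close>

definition tri :: "nat \<Rightarrow> nat" where
  "tri t = t * (t + 1) div 2"

lemma double_tri: "2 * tri t = t * (t + 1)"
  unfolding tri_def by simp

lemma tri_0 [simp]: "tri 0 = 0" and tri_Suc [simp]: "tri (Suc t) = tri t + Suc t"
  unfolding tri_def by simp_all

text \<open>The second form matches terms in which the simplifier has turned \<open>1\<close> into \<open>Suc 0\<close>.\<close>

lemma sum_eq_tri: "\<Sum>{1..t} = tri t" "\<Sum>{Suc 0..t} = tri t"
proof -
  show "\<Sum>{1..t} = tri t" by (induction t) simp_all
  then show "\<Sum>{Suc 0..t} = tri t" by simp
qed

lemma tri_mono: "s \<le> t \<Longrightarrow> tri s \<le> tri t"
  unfolding tri_def by (intro div_le_mono mult_le_mono) simp_all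

lemma tri_card_le_sum:
  fixes A :: "nat set"
  assumes "finite A" "0 \<notin> A"
  shows "tri (card A) \<le> \<Sum>A"
  using assms
proof (induction A rule: finite_linorder_max_induct)
  case (insert b A)
  have "insert b A \<subseteq> {1..b}"
  proof
    fix x assume "x \<in> insert b A"
    then have "x \<noteq> 0" "x \<le> b" using insert by (metis, fastforce)
    then show "x \<in> {1..b}" by simp
  qed
  then have "card (insert b A) \<le> card {1..b}" by (intro card_mono) simp_all
  then show ?case using insert by auto
qed simp

lemma tri_le_sum_permutes:
  assumes "\<sigma> permutes {1..n}" "t \<le> n"
  shows "tri t \<le> (\<Sum>i=1..t. \<sigma> i)"
proof -
  have inj: "inj_on \<sigma> {1..t}" using assms(1) permutes_inj inj_on_subset by blast
  have "\<sigma> ` {1..t} \<subseteq> {1..n}"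
    using assms permutes_image[OF assms(1)] by (metis atLeastatMost_subset_iff image_mono order_refl)
  then have "0 \<notin> \<sigma> ` {1..t}" by auto
  then have "tri (card (\<sigma> ` {1..t})) \<le> \<Sum>(\<sigma> ` {1..t})" by (intro tri_card_le_sum) auto
  then show ?thesis using inj by (simp add: card_image sum.reindex)
qed

lemma sum_permutes:
  assumes "\<sigma> permutes {1..n}"
  shows "sum \<sigma> {1..n} = tri n"
  using sum_eq_tri(1)[of n] sum.permute[OF assms, of "\<lambda>x. x"] by (simp add: o_def)

lemma permutes_eq_top:
  fixes \<sigma> :: "nat \<Rightarrow> nat"
  assumes "\<sigma> permutes {1..n}" "1 \<le> n" "n \<le> \<sigma> n"
  shows "\<sigma> n = n"
proof -
  have "n \<in> {1..n}" using assms(2) by simp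
  then have "\<sigma> n \<in> {1..n}" by (rule permutes_in_image[OF assms(1), THEN iffD2])
  then show ?thesis using assms(3) by simp
qed

section \<open>Weighings that determine a coin\<close>

definition two_weighings_suffice :: "nat \<Rightarrow> bool" where
  "two_weighings_suffice n \<longleftrightarrow>
    (\<exists>ws. length ws \<le> 2 \<and> set ws \<subseteq> weighings n \<and> determines_some_coin n ws)"

lemma outcome_eq_id_cases:
  assumes "outcome \<sigma> (L, R) = outcome id (L, R)"
  shows "\<Sum>L = \<Sum>R \<Longrightarrow> sum \<sigma> L = sum \<sigma> R" "\<Sum>L < \<Sum>R \<Longrightarrow> sum \<sigma> L < sum \<sigma> R"
proof -
  have "sgn (int (sum \<sigma> L) - int (sum \<sigma> R)) = sgn (int (\<Sum>L) - int (\<Sum>R))"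
    using assms unfolding outcome_def by simp
  moreover have cmp: "sgn (int p - int q) = (if p < q then - 1 else if p = q then 0 else 1)" for p q
    by (simp add: sgn_if)
  ultimately have "(if sum \<sigma> L < sum \<sigma> R then - 1 else if sum \<sigma> L = sum \<sigma> R then 0 else 1 :: int)
      = (if \<Sum>L < \<Sum>R then - 1 else if \<Sum>L = \<Sum>R then 0 else 1)"
    by (simp only: cmp)
  then show "\<Sum>L = \<Sum>R \<Longrightarrow> sum \<sigma> L = sum \<sigma> R" "\<Sum>L < \<Sum>R \<Longrightarrow> sum \<sigma> L < sum \<sigma> R"
    by (simp_all split: if_splits)
qed

lemma two_weighings_sufficeI:
  assumes "length ws \<le> 2" "set ws \<subseteq> weighings n" "k \<in> {1..n}"
    and "\<And>\<sigma>. \<sigma> permutes {1..n} \<Longrightarrow> (\<And>L R. (L, R) \<in> set ws \<Longrightarrow> \<Sum>L = \<Sum>R \<Longrightarrow> sum \<sigma> L = sum \<sigma> R) \<Longrightarrow>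
      (\<And>L R. (L, R) \<in> set ws \<Longrightarrow> \<Sum>L < \<Sum>R \<Longrightarrow> sum \<sigma> L < sum \<sigma> R) \<Longrightarrow> \<sigma> k = k"
  shows "two_weighings_suffice n"
proof -
  have "determines n ws k"
    unfolding determines_def consistent_def
  proof (intro allI impI, elim conjE)
    fix \<sigma> assume \<sigma>: "\<sigma> permutes {1..n}" and eq: "\<forall>w\<in>set ws. outcome \<sigma> w = outcome id w"
    show "\<sigma> k = k"
      by (rule assms(4)[OF \<sigma>]) (use eq outcome_eq_id_cases in blast)+
  qed
  then show ?thesis
    using assms(1-3) unfolding two_weighings_suffice_def determines_some_coin_def by blast
qed

text \<open>
  Any \<open>m\<close> coins together weigh at least \<open>tri m\<close>, so a coin that balances them when
  \<open>n = tri m\<close>, or outweighs them when \<open>n = tri m + 1\<close>, weighs at least \<open>n\<close>.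
\<close>

lemma one_weighing:
  assumes "1 \<le> m" "m < n" "tri m \<le> n" "n \<le> tri m + 1"
  shows "two_weighings_suffice n"
proof (rule two_weighings_sufficeI[where ws = "[({1..m}, {n})]" and k = n])
  show "set [({1..m}, {n})] \<subseteq> weighings n" using assms by (auto simp: weighings_def)
  fix \<sigma> assume \<sigma>: "\<sigma> permutes {1..n}"
    and eq: "\<And>L R. (L, R) \<in> set [({1..m}, {n})] \<Longrightarrow> \<Sum>L = \<Sum>R \<Longrightarrow> sum \<sigma> L = sum \<sigma> R"
    and less: "\<And>L R. (L, R) \<in> set [({1..m}, {n})] \<Longrightarrow> \<Sum>L < \<Sum>R \<Longrightarrow> sum \<sigma> L < sum \<sigma> R"
  have "tri m \<le> (\<Sum>i=1..m. \<sigma> i)" using tri_le_sum_permutes[OF \<sigma>] assms by simp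
  then have "n \<le> \<sigma> n"
    using eq[of "{1..m}" "{n}"] less[of "{1..m}" "{n}"] assms by (cases "tri m = n") (auto simp: sum_eq_tri)
  then show "\<sigma> n = n" using permutes_eq_top[OF \<sigma>] assms by simp
qed (use assms in auto)

lemma sum_upto_split:
  fixes g :: "nat \<Rightarrow> nat"
  assumes "i \<le> j"
  shows "sum g {1..i} + sum g {i+1..j} = sum g {1..j}"
proof -
  have "{1..j} = {1..i} \<union> {i+1..j}" using assms by auto
  moreover have "sum g ({1..i} \<union> {i+1..j}) = sum g {1..i} + sum g {i+1..j}"
    by (intro sum.union_disjoint) auto
  ultimately show ?thesis by simp
qed

text \<open>
  The key construction. For any weights \<open>g\<close> with partial sums \<open>G t\<close>, twice the imbalance of the first
  weighing plus the imbalance of the second is \<open>G a + G b + G c + G d - G n - g n\<close>: the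
  contributions of \<open>m\<close> and \<open>P\<close> cancel. For the true weights it is \<open>0\<close> by the
  hypothesis on triangular numbers, which turns balance of the first weighing into balance of the second.
\<close>

lemma two_weighings:
  assumes ord: "a \<le> b" "b \<le> m" "m \<le> c" "c \<le> d" "d < n"
    and tris: "tri a + tri b + tri c + tri d = tri n + n"
    and P: "P \<subseteq> {d+1..n-1}" "P \<noteq> {}" "\<Sum>P + n = tri m"
  shows "two_weighings_suffice n"
proof -
  define L1 R1 L2 R2 where defs: "L1 = {1..m}" "R1 = insert n P"
    "L2 = {1..a} \<union> {m+1..c} \<union> P" "R2 = {b+1..m} \<union> ({d+1..n-1} - P)"
  have fin: "finite P" using P(1) finite_subset by blast
  have range: "d < x \<and> x < n" if "x \<in> P" for x
    using that P(1) ord by fastforce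
  then have nP: "n \<notin> P" by blast
  have L1: "sum g L1 = sum g {1..m}" and R1: "sum g R1 = sum g P + g n" for g :: "nat \<Rightarrow> nat"
    using fin nP unfolding defs by simp_all
  have L2: "sum g L2 + sum g {1..m} = sum g {1..a} + sum g {1..c} + sum g P" for g :: "nat \<Rightarrow> nat"
  proof -
    have "sum g L2 = sum g ({1..a} \<union> {m+1..c}) + sum g P"
      unfolding defs using fin P(1) ord by (intro sum.union_disjoint) auto
    also have "sum g ({1..a} \<union> {m+1..c}) = sum g {1..a} + sum g {m+1..c}"
      using ord by (intro sum.union_disjoint) auto
    finally show ?thesis using sum_upto_split[OF ord(3), of g] by simp
  qed
  have R2: "sum g R2 + sum g {1..b} + sum g {1..d} + sum g P + g n = sum g {1..m} + sum g {1..n}"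
    for g :: "nat \<Rightarrow> nat"
  proof -
    have "sum g R2 = sum g {b+1..m} + sum g ({d+1..n-1} - P)"
      unfolding defs using ord by (intro sum.union_disjoint) auto
    moreover have "sum g ({d+1..n-1} - P) + sum g P = sum g {d+1..n-1}"
      using P(1) by (simp add: sum.subset_diff)
    moreover have "sum g {1..d} + sum g {d+1..n-1} = sum g {1..n-1}"
      using sum_upto_split[of d "n-1" g] ord by simp
    moreover have "sum g {1..n-1} + g n = sum g {1..n}" using ord by (cases n) auto
    ultimately show ?thesis using sum_upto_split[OF ord(2), of g] by simp
  qed
  have bal1: "\<Sum>L1 = \<Sum>R1"
    using L1[of "\<lambda>x. x"] R1[of "\<lambda>x. x"] P(3) by (simp add: sum_eq_tri)
  have bal2: "\<Sum>L2 = \<Sum>R2"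
    using L2[of "\<lambda>x. x"] R2[of "\<lambda>x. x"] P(3) tris by (simp add: sum_eq_tri)
  have "R2 \<noteq> {}"
  proof
    assume "R2 = {}"
    then have "\<Sum>L2 = 0" using bal2 by simp
    moreover have "finite L2" unfolding defs using fin by simp
    ultimately have "\<forall>x\<in>L2. x = 0" by (simp only: sum_eq_0_iff)
    moreover obtain x where "x \<in> P" using P(2) by blast
    ultimately have "x = 0" unfolding defs by blast
    then show False using P(1) \<open>x \<in> P\<close> by auto
  qed
  show ?thesis
  proof (rule two_weighings_sufficeI[where ws = "[(L1, R1), (L2, R2)]" and k = n])
    have "1 \<le> m" using P(3) ord by (cases m) auto
    then show "set [(L1, R1), (L2, R2)] \<subseteq> weighings n"
      using ord P(2) \<open>R2 \<noteq> {}\<close> range unfolding weighings_def defs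
      by (fastforce dest: range)
    fix \<sigma> assume \<sigma>: "\<sigma> permutes {1..n}"
      and eq: "\<And>L R. (L, R) \<in> set [(L1, R1), (L2, R2)] \<Longrightarrow> \<Sum>L = \<Sum>R \<Longrightarrow> sum \<sigma> L = sum \<sigma> R"
    have 1: "sum \<sigma> L1 = sum \<sigma> R1" and 2: "sum \<sigma> L2 = sum \<sigma> R2"
      using eq bal1 bal2 by simp_all
    have "sum \<sigma> {1..n} = tri n" by (rule sum_permutes[OF \<sigma>])
    then have "sum \<sigma> {1..a} + sum \<sigma> {1..b} + sum \<sigma> {1..c} + sum \<sigma> {1..d} = tri n + \<sigma> n"
      using 1 2 L1[of \<sigma>] R1[of \<sigma>] L2[of \<sigma>] R2[of \<sigma>] by simp
    then have "n \<le> \<sigma> n"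
      using tri_le_sum_permutes[OF \<sigma>, of a] tri_le_sum_permutes[OF \<sigma>, of b]
        tri_le_sum_permutes[OF \<sigma>, of c] tri_le_sum_permutes[OF \<sigma>, of d] ord tris by simp
    then show "\<sigma> n = n" using permutes_eq_top[OF \<sigma>] ord by simp
  qed (use ord in auto)
qed

section \<open>Subset sums of an interval\<close>

text \<open>
  Since \<open>v + tri k \<le> k * (s + 1)\<close> bounds \<open>v\<close> by the sum of the \<open>k\<close> largest elements, the claim is
  that every sum between the extreme ones occurs. Either \<open>v\<close> is reachable without the largest element
  \<open>s\<close>, or taking \<open>s\<close> leaves a target within the range for \<open>k - 1\<close> of the other elements.
\<close>

lemma subset_sum_interval:
  assumes "k \<le> s" "tri k \<le> v" "v + tri k \<le> k * (s + 1)"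
  shows "\<exists>A. A \<subseteq> {1..s} \<and> card A = k \<and> \<Sum>A = v"
  using assms
proof (induction s arbitrary: k v)
  case 0
  then show ?case by auto
next
  case (Suc s)
  show ?case
  proof (cases "v + tri k \<le> k * (s + 1) \<and> k \<le> s")
    case True
    then obtain A where "A \<subseteq> {1..s}" "card A = k" "\<Sum>A = v" using Suc by blast
    then show ?thesis by (intro exI[of _ A]) auto
  next
    case False
    have "k \<noteq> 0" using False Suc.prems by auto
    then obtain l where k: "k = Suc l" by (cases k) auto
    have ls: "l \<le> s" using Suc.prems k by simp
    have D: "2 * tri l = l * (l + 1)" by (rule double_tri)
    have low: "tri l + Suc s \<le> v"
    proof (cases "k \<le> s")
      case True
      then have "k * (s + 1) < v + tri k" using False by simp
      moreover have "l * (l + 1) \<le> l * s" using True k by (intro mult_left_mono) auto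
      ultimately show ?thesis using k D by (simp add: algebra_simps)
    next
      case False
      then show ?thesis using Suc.prems k by simp
    qed
    obtain u where u: "v = Suc s + u" using low le_Suc_ex[of "Suc s" v] by auto
    have "u + tri l \<le> l * (s + 1)" using Suc.prems(3) k u by simp
    then obtain A where A: "A \<subseteq> {1..s}" "card A = l" "\<Sum>A = u"
      using Suc.IH[of l u] ls low u by auto
    have fin: "finite A" using A(1) finite_subset by blast
    moreover have "Suc s \<notin> A" using A(1) by auto
    ultimately show ?thesis using A k u by (intro exI[of _ "insert (Suc s) A"]) auto
  qed
qed

text \<open>
  The parameters of lemma \<open>two_weighings\<close> with the set \<open>P\<close> replaced by its cardinality \<open>k\<close>: the
  last two inequalities say that \<open>tri m - n\<close> lies between the smallest and the largest sum of \<open>k\<close>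
  elements of \<open>{d+1..n-1}\<close>.
\<close>

definition certificate :: "nat \<Rightarrow> nat \<times> nat \<times> nat \<times> nat \<times> nat \<times> nat \<Rightarrow> bool" where
  "certificate n = (\<lambda>(a, b, m, c, d, k). a \<le> b \<and> b \<le> m \<and> m \<le> c \<and> c \<le> d \<and> 1 \<le> k \<and> d + k < n
    \<and> tri a + tri b + tri c + tri d = tri n + n
    \<and> k * d + tri k + n \<le> tri m \<and> tri m + tri k \<le> k * n + n)"

lemma certificate_imp_two_weighings_suffice:
  assumes "certificate n (a, b, m, c, d, k)"
  shows "two_weighings_suffice n"
proof -
  have h: "a \<le> b" "b \<le> m" "m \<le> c" "c \<le> d" "1 \<le> k" "d + k < n"
    "tri a + tri b + tri c + tri d = tri n + n"
    "k * d + tri k + n \<le> tri m" "tri m + tri k \<le> k * n + n"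
    using assms unfolding certificate_def by auto
  obtain e where e: "n = d + k + Suc e" using h(6) less_imp_Suc_add by fastforce
  obtain v where v: "tri m = k * d + n + v" using h(8) le_Suc_ex[of "k * d + n" "tri m"] by auto
  have "tri k \<le> v" "v + tri k \<le> k * (k + e + 1)"
    using h(8,9) unfolding v by (simp_all add: e distrib_left)
  then obtain A where A: "A \<subseteq> {1..k + e}" "card A = k" "\<Sum>A = v"
    using subset_sum_interval[of k "k + e" v] by auto
  define P where "P = (\<lambda>x. x + d) ` A"
  have "\<Sum>P = (\<Sum>x\<in>A. x + d)" unfolding P_def by (simp add: sum.reindex)
  then have "\<Sum>P + n = tri m" using A v by (simp add: sum.distrib)
  moreover have "P \<noteq> {}" using A(2) h unfolding P_def by auto
  moreover have "P \<subseteq> {d+1..n-1}" using A(1) e unfolding P_def by auto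
  ultimately show ?thesis using two_weighings[of a b m c d n P] h by simp
qed

section \<open>Many coins\<close>

lemma odd_square_eq_tri: "(2 * int t + 1)\<^sup>2 = 8 * int (tri t) + 1"
proof -
  have "2 * int (tri t) = int t * (int t + 1)" using arg_cong[OF double_tri, of int t] by (simp add: algebra_simps)
  then show ?thesis by (simp add: power2_eq_square algebra_simps)
qed

lemma odd_int_cases:
  assumes "odd (i :: int)" "0 \<le> i"
  obtains t where "i = 2 * int t + 1"
proof -
  obtain j where "i = 2 * j + 1" using assms(1) by (elim oddE)
  with assms(2) show thesis using that[of "nat j"] by simp
qed

text \<open>
  With \<open>n\<^sup>2 + 3 n + 1 = w\<^sup>2 + x\<^sup>2 + y\<^sup>2 + z\<^sup>2\<close>, the numbers \<open>2 t + 1\<close> for the four \<open>t\<close> are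
  the entries of \<open>(w, x, y, z)\<close> under a matrix of signs with orthogonal rows, which multiplies the sum
  of squares by \<open>4\<close>. Of the two such matrices, the one without the entry \<open>w + x + y + z\<close> is chosen,
  because Cauchy's inequality then bounds the largest entry by \<open>(w + x + y)\<^sup>2 \<le> 3 (w\<^sup>2 + x\<^sup>2 + y\<^sup>2)\<close>.
\<close>

lemma four_tri:
  fixes n :: nat
  obtains a b c d where "a \<le> b" "b \<le> c" "c \<le> d" "tri a + tri b + tri c + tri d = tri n + n"
    "8 * tri d \<le> 3 * n\<^sup>2 + 9 * n + 2"
proof -
  obtain w x y z :: int where sq: "int (n\<^sup>2 + 3 * n + 1) = w\<^sup>2 + x\<^sup>2 + y\<^sup>2 + z\<^sup>2"
    and ord: "w \<ge> x" "x \<ge> y" "y \<ge> z" "z \<ge> 0"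
    by (rule four_squares_sorted)
  have "odd (n\<^sup>2 + 3 * n + 1)" by simp
  then have "odd (w\<^sup>2 + x\<^sup>2 + y\<^sup>2 + z\<^sup>2)" unfolding sq[symmetric] by (simp only: even_of_nat not_False_eq_True)
  then have odd: "odd (w + x + y + z)" by simp
  obtain d where d: "w + x + y - z = 2 * int d + 1" using odd ord by (elim odd_int_cases[rotated 2]) auto
  obtain c where c: "w + x - y + z = 2 * int c + 1" using odd ord by (elim odd_int_cases[rotated 2]) auto
  obtain b where b: "w - x + y + z = 2 * int b + 1" using odd ord by (elim odd_int_cases[rotated 2]) auto
  obtain a where a: "\<bar>w - x - y - z\<bar> = 2 * int a + 1" using odd by (elim odd_int_cases[rotated 2]) auto
  have "int (8 * (tri a + tri b + tri c + tri d) + 4)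
      = (w - x - y - z)\<^sup>2 + (w - x + y + z)\<^sup>2 + (w + x - y + z)\<^sup>2 + (w + x + y - z)\<^sup>2"
    unfolding power2_abs[of "w - x - y - z", symmetric] a b c d odd_square_eq_tri by simp
  also have "\<dots> = 4 * (w\<^sup>2 + x\<^sup>2 + y\<^sup>2 + z\<^sup>2)" by (simp add: power2_eq_square algebra_simps)
  also have "\<dots> = int (4 * (n\<^sup>2 + 3 * n + 1))" using sq by simp
  finally have "8 * (tri a + tri b + tri c + tri d) + 4 = 4 * (n\<^sup>2 + 3 * n + 1)" by (simp only: of_nat_eq_iff)
  then have sum: "tri a + tri b + tri c + tri d = tri n + n"
    using double_tri[of n] by (simp add: power2_eq_square)
  have "(w + x + y - z)\<^sup>2 \<le> (w + x + y)\<^sup>2" using ord by (intro power_mono) auto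
  also have "\<dots> = 3 * (w\<^sup>2 + x\<^sup>2 + y\<^sup>2) - (w - x)\<^sup>2 - (w - y)\<^sup>2 - (x - y)\<^sup>2"
    by (simp add: power2_eq_square algebra_simps)
  also have "\<dots> \<le> 3 * (w\<^sup>2 + x\<^sup>2 + y\<^sup>2 + z\<^sup>2)"
    by (smt (verit) zero_le_power2)
  finally have "int (8 * tri d + 1) \<le> int (3 * (n\<^sup>2 + 3 * n + 1))"
    unfolding d odd_square_eq_tri sq[symmetric] by simp
  then have "8 * tri d + 1 \<le> 3 * (n\<^sup>2 + 3 * n + 1)" by (simp only: of_nat_le_iff)
  then have "8 * tri d \<le> 3 * n\<^sup>2 + 9 * n + 2" by (simp add: algebra_simps)
  moreover have "a \<le> b" "b \<le> c" "c \<le> d" using a b c d ord by linarith+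
  ultimately show thesis using that sum by blast
qed

text \<open>
  Let \<open>s = n - 1 - d\<close> be the length of the interval \<open>{d+1..n-1}\<close>. The sums of \<open>j\<close> and of \<open>j + 1\<close> of its
  elements leave no gap as soon as \<open>j (s - 1 - j) \<ge> d\<close>. As \<open>d \<le> 7 n / 8\<close>, this holds for
  \<open>12 \<le> j \<le> s - 13\<close>, and so every number from \<open>K = 12 d + 78\<close>, the least sum of \<open>12\<close> elements
  of \<open>{d+1..n-1}\<close>, up to the total minus \<open>K\<close> is a subset sum. It is therefore enough to find
  \<open>m\<close> with \<open>tri m - n\<close> in this range. All these estimates compare a multiple of \<open>n\<^sup>2\<close> with a
  multiple of \<open>n\<close>, and \<open>n\<^sup>2 \<ge> 300 n\<close> suffices for them.
\<close>

lemma large_certificate: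
  fixes n :: nat
  assumes "300 \<le> n"
  shows "\<exists>r. certificate n r"
proof -
  have n2: "300 * n \<le> n\<^sup>2" using assms by (simp add: power2_eq_square)
  obtain a b c d where ord: "a \<le> b" "b \<le> c" "c \<le> d" and sum: "tri a + tri b + tri c + tri d = tri n + n"
    and dub: "8 * tri d \<le> 3 * n\<^sup>2 + 9 * n + 2"
    by (rule four_tri)
  have tn: "2 * tri n = n\<^sup>2 + n" using double_tri[of n] by (simp add: power2_eq_square)
  have d7: "8 * d \<le> 7 * n"
  proof (rule ccontr)
    assume "\<not> 8 * d \<le> 7 * n"
    then have "(7 * n)\<^sup>2 \<le> (8 * d)\<^sup>2" by (intro power_mono) auto
    moreover have "(8 * d)\<^sup>2 \<le> 16 * (8 * tri d)" using double_tri[of d] by (simp add: power2_eq_square)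
    ultimately have "49 * n\<^sup>2 \<le> 16 * (3 * n\<^sup>2 + 9 * n + 2)" using dub by (simp add: power_mult_distrib)
    then show False using n2 assms by simp
  qed
  obtain s where s: "n = d + s + 1" using d7 assms less_imp_Suc_add[of d n] by auto
  define K where "K = 12 * d + 78"
  have cl: "n + K \<le> tri c"
    using sum dub tn tri_mono[OF ord(1)] tri_mono[OF ord(2)] d7 n2 assms unfolding K_def by linarith
  \<comment> \<open>The least \<open>m\<close> with \<open>tri m - n \<ge> K\<close> is used: it overshoots by at most \<open>m\<close>, unless \<open>m = b\<close>.\<close>
  have ex: "\<exists>m. b \<le> m \<and> n + K \<le> tri m" using cl ord by blast
  define m where "m = (LEAST m. b \<le> m \<and> n + K \<le> tri m)"
  have m: "b \<le> m" "n + K \<le> tri m" using LeastI_ex[OF ex] unfolding m_def by auto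
  have mc: "m \<le> c" unfolding m_def using cl ord by (intro Least_le) auto
  have mu: "tri m + tri d + K \<le> tri n"
  proof (cases "m = b")
    case True
    then show ?thesis using sum cl by simp
  next
    case False
    then obtain l where l: "m = Suc l" "b \<le> l" using m(1) by (cases m) auto
    have "\<not> (b \<le> l \<and> n + K \<le> tri l)" using l not_less_Least[of l] unfolding m_def by (metis lessI)
    then have "tri m \<le> n + K + m" using l by simp
    then show ?thesis using mc ord d7 dub tn n2 assms unfolding K_def by linarith
  qed
  have s24: "24 \<le> s" "d \<le> 12 * (s - 13)" using d7 assms s by simp_all
  \<comment> \<open>The largest sum of \<open>s - 12\<close> elements is the total minus \<open>K\<close>.\<close>
  have top: "tri m + tri (s - 12) \<le> (s - 12) * n + n"
  proof -
    obtain u where u: "s = u + 12" using s24 le_Suc_ex[of 12 s] by (auto simp: add.commute)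
    have n: "n = d + u + 13" unfolding s u by simp
    have e: "2 * tri n = (d + u + 13) * (d + u + 14)"
      unfolding double_tri n by simp
    have "2 * tri m + 2 * tri d + 2 * K \<le> 2 * tri n" using mu by simp
    then have "2 * tri m + d * (d + 1) + 2 * (12 * d + 78) \<le> (d + u + 13) * (d + u + 14)"
      by (simp only: e double_tri[of d] K_def)
    then have "2 * tri m + u * (u + 1) \<le> 2 * (u * (d + u + 13) + (d + u + 13))"
      by (simp add: algebra_simps)
    then have "2 * (tri m + tri u) \<le> 2 * (u * (d + u + 13) + (d + u + 13))"
      by (simp only: distrib_left[of 2 "tri m"] double_tri[of u])
    then have "tri m + tri u \<le> u * (d + u + 13) + (d + u + 13)"
      by (rule mult_left_le_imp_le) simp
    then show ?thesis unfolding u n by simp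
  qed
  \<comment> \<open>The least \<open>k\<close> whose largest sum reaches \<open>tri m - n\<close>: by the overlap, its smallest sum is below it.\<close>
  have ex2: "\<exists>k. 12 \<le> k \<and> tri m + tri k \<le> k * n + n" using top s24 by (intro exI[of _ "s - 12"]) auto
  define k where "k = (LEAST k. 12 \<le> k \<and> tri m + tri k \<le> k * n + n)"
  have k: "12 \<le> k" "tri m + tri k \<le> k * n + n" using LeastI_ex[OF ex2] unfolding k_def by auto
  have ks: "k \<le> s - 12" unfolding k_def using top s24 by (intro Least_le) auto
  have low: "k * d + tri k + n \<le> tri m"
  proof (cases "k = 12")
    case True
    then show ?thesis using m(2) unfolding K_def by (simp add: tri_def)
  next
    case False
    then obtain j where j: "k = Suc j" "12 \<le> j" using k(1) by (cases k) auto
    have "\<not> (12 \<le> j \<and> tri m + tri j \<le> j * n + n)" using j not_less_Least[of j] unfolding k_def by (metis lessI)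
    then have gt: "j * n + n < tri m + tri j" using j by simp
    have "j + 13 \<le> s" using ks j s24 by linarith
    then obtain i where i: "s = j + 13 + i" using le_Suc_ex by blast
    obtain h where h: "j = 12 + h" using j(2) le_Suc_ex by blast
    \<comment> \<open>\<open>j (s - 1 - j) \<ge> 12 (s - 13)\<close>, as a product with given sum is least at the extreme factors.\<close>
    have "d \<le> 12 * (h + 12 + i)" using s24(2) unfolding i h by simp
    also have "\<dots> \<le> (12 + h) * (12 + i)" by (simp add: algebra_simps)
    finally have "d \<le> j * (12 + i)" using h by simp
    then show ?thesis using gt double_tri[of j] unfolding s i j(1) by (simp add: algebra_simps)
  qed
  have "certificate n (a, b, m, c, d, k)"
    unfolding certificate_def using ord m(1) mc k ks s24 s sum low by simp
  then show ?thesis by blast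
qed

section \<open>Few coins\<close>

fun certificates_from :: "nat \<Rightarrow> (nat \<times> nat \<times> nat \<times> nat \<times> nat \<times> nat) list \<Rightarrow> bool" where
  "certificates_from n [] \<longleftrightarrow> True"
| "certificates_from n (r # rs) \<longleftrightarrow> certificate n r \<and> certificates_from (n + 1) rs"

text \<open>
  The rows belong to \<open>n = 11, 12, \<dots>, 299\<close>; each is found by searching through the
  representations of \<open>tri n + n\<close> as a sum of four triangular numbers.
\<close>

definition certificate_table :: "(nat \<times> nat \<times> nat \<times> nat \<times> nat \<times> nat) list" where
  "certificate_table =
  [(1,2,6,7,9,1), (2,5,6,8,8,1), (1,2,8,9,10,2), (1,7,8,9,9,2), (1,1,7,10,12,1),
   (0,3,9,10,13,2), (1,8,9,10,12,2), (0,3,11,12,14,3), (1,3,8,11,16,1), (0,2,10,13,16,2),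
   (0,6,12,12,17,3), (0,2,12,16,16,3), (1,1,9,11,21,1), (2,3,9,14,20,1), (1,2,13,16,20,3),
   (0,4,15,16,21,4), (0,0,12,14,24,2), (0,7,10,10,26,1), (0,2,10,16,25,1), (2,6,10,18,24,1),
   (3,3,18,19,25,5), (0,1,13,17,28,2), (0,3,13,20,27,2), (2,4,11,15,31,1), (0,4,11,19,30,1),
   (0,6,14,15,33,2), (1,1,14,20,32,2), (4,4,14,21,32,2), (5,10,14,22,31,2), (1,2,12,17,37,1),
   (4,5,15,16,38,2), (1,4,15,21,37,2), (0,4,15,23,37,2), (0,1,20,22,39,4), (1,3,18,22,40,3),
   (0,1,13,16,44,1), (2,8,13,19,43,1), (0,6,13,24,42,1), (1,7,19,20,45,3), (0,4,19,25,44,3),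
   (2,3,19,27,44,3), (0,5,17,19,49,2), (1,6,14,16,51,1), (1,4,14,22,50,1), (0,9,14,25,49,1),
   (0,6,20,28,49,3), (0,0,25,29,50,5), (2,8,18,19,55,2), (0,13,18,22,54,2), (4,5,21,25,55,3),
   (0,4,15,21,58,1), (1,4,15,26,57,1), (2,5,15,30,56,1), (4,4,24,32,56,4), (5,7,19,23,61,2),
   (3,3,19,29,60,2), (1,11,25,25,62,4), (3,6,25,31,61,4), (4,4,16,22,66,1), (1,2,16,28,65,1),
   (0,7,20,22,68,2), (1,5,20,28,67,2), (0,0,20,31,67,2), (5,7,20,34,66,2), (0,9,29,30,69,5),
   (3,10,29,34,68,5), (4,4,17,20,75,1), (2,3,21,24,75,2), (1,7,21,29,74,2), (6,7,21,31,74,2),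
   (1,14,21,34,73,2), (1,2,21,39,73,2), (10,10,25,27,78,3), (3,3,25,33,78,3), (1,7,25,35,78,3),
   (1,2,18,22,84,1), (3,9,18,27,83,1), (0,3,18,34,82,1), (0,7,29,31,84,4), (1,1,26,32,85,3),
   (1,2,26,37,84,3), (4,4,26,39,84,3), (2,5,23,26,90,2), (2,10,23,31,89,2), (7,8,30,31,90,4),
   (0,2,19,27,93,1), (1,4,19,33,92,1), (1,6,19,38,91,1), (1,1,27,41,91,3), (4,4,27,45,90,3),
   (4,11,24,25,98,2), (1,3,24,34,97,2), (2,4,28,31,99,3), (0,4,28,37,98,3), (2,8,28,39,98,3),
   (0,5,20,28,103,1), (1,1,20,35,102,1), (0,0,32,38,102,4), (2,7,32,40,102,4), (1,5,25,32,106,2),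
   (3,10,29,34,106,3), (0,10,25,40,105,2), (5,7,29,43,105,3), (5,5,36,41,107,5), (0,4,33,39,109,4),
   (1,6,21,25,114,1), (2,5,21,33,113,1), (1,2,26,30,115,2), (0,1,26,37,114,2), (0,9,26,39,114,2),
   (2,4,34,37,116,4), (2,3,34,43,115,4), (7,14,34,43,115,4), (0,7,34,48,115,4), (1,2,34,51,115,4),
   (5,7,31,37,121,3), (1,1,22,27,125,1), (1,2,22,35,124,1), (3,6,22,41,123,1), (3,10,22,46,122,1),
   (6,7,27,49,122,2), (0,0,42,45,125,6), (3,13,39,43,126,5), (0,13,32,37,129,3), (3,6,32,42,129,3),
   (3,7,36,42,130,4), (2,4,28,36,133,2), (2,9,28,42,132,2), (4,5,23,32,136,1), (0,4,23,40,135,1),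
   (3,11,23,45,134,1), (1,6,33,40,137,3), (7,10,33,42,137,3), (0,2,33,47,137,3), (1,1,37,50,137,4),
   (4,4,29,33,143,2), (1,4,29,41,142,2), (2,7,29,44,142,2), (4,7,29,50,141,2), (8,17,29,50,141,2),
   (0,3,24,34,148,1), (7,18,24,37,147,1), (0,6,42,45,147,5), (7,10,42,50,146,5), (1,7,42,54,146,5),
   (5,9,30,33,153,2), (1,7,30,42,152,2), (0,4,30,46,152,2), (2,3,35,39,155,3), (2,6,35,46,154,3),
   (3,8,35,49,154,3), (5,19,35,49,154,3), (10,10,25,27,161,1), (3,7,25,39,160,1), (3,3,25,47,159,1),
   (7,10,40,42,161,4), (2,3,31,40,163,2), (5,12,36,38,164,3), (6,11,36,46,163,3), (2,4,36,51,163,3),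
   (0,6,48,51,164,6), (2,7,48,57,163,6), (0,7,48,60,163,6), (3,16,48,61,163,6), (3,7,41,48,169,4),
   (2,7,26,31,174,1), (1,1,32,37,174,2), (6,13,32,43,173,2), (2,4,32,49,173,2), (12,16,32,52,172,2),
   (1,2,32,59,172,2), (1,2,56,62,172,8), (9,9,42,48,177,4), (4,4,42,53,177,4), (3,13,42,55,177,4),
   (1,14,50,55,178,6), (2,7,38,46,182,3), (1,9,33,37,185,2), (5,7,33,46,184,2), (1,5,27,38,187,1),
   (0,10,27,46,186,1), (0,2,43,51,186,4), (1,10,43,57,185,4), (2,4,43,61,185,4), (4,4,43,64,185,4),
   (4,5,55,58,188,7), (0,13,39,46,192,3), (0,9,39,51,192,3), (2,7,48,55,192,5), (1,2,34,44,196,2),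
   (0,11,34,51,195,2), (0,10,34,55,195,2), (1,7,56,59,195,7), (3,11,28,38,201,1), (1,13,28,47,200,1),
   (2,7,28,56,199,1), (1,3,40,49,202,3), (0,4,40,53,202,3), (4,17,45,46,204,4), (0,3,45,57,203,4),
   (0,6,35,40,208,2), (1,8,35,49,207,2), (0,9,35,53,207,2), (1,3,35,61,206,2), (6,13,50,52,209,5),
   (4,5,50,61,208,5), (1,11,41,49,212,3), (2,10,29,34,216,1), (6,12,29,44,215,1), (2,13,29,53,214,1),
   (5,10,29,61,213,1), (3,9,29,68,212,1), (0,7,36,41,220,2), (0,22,36,46,219,2), (4,4,36,55,219,2),
   (4,14,36,61,218,2), (1,17,36,64,218,2), (7,10,42,50,223,3), (9,10,42,58,222,3), (5,16,42,61,222,3),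
   (6,8,56,59,224,6), (0,3,56,67,223,6), (1,16,30,33,231,1), (0,8,30,47,230,1), (3,7,30,56,229,1),
   (1,9,37,47,232,2), (2,9,37,56,231,2), (1,10,43,47,234,3), (13,16,43,53,233,3), (2,11,43,60,233,3),
   (4,11,53,56,235,5), (5,10,53,64,234,5), (2,9,53,68,234,5), (1,4,53,72,234,5), (10,10,53,74,234,5),
   (0,14,69,71,236,9), (2,13,49,52,242,4), (5,7,38,43,245,2), (0,2,31,44,246,1), (6,13,31,52,245,1),
   (3,7,31,62,244,1), (1,7,44,66,244,3), (1,8,44,73,243,3), (1,11,44,76,243,3), (2,3,44,80,243,3),
   (4,10,59,66,248,6), (4,13,50,53,252,4), (3,6,50,63,251,4), (4,5,50,67,251,4), (5,7,55,63,253,5),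
   (0,3,39,45,258,2), (1,6,39,55,257,2), (1,10,39,59,257,2), (1,1,39,68,256,2), (1,6,32,45,262,1),
   (1,9,32,55,261,1), (6,12,32,63,260,1), (2,7,51,60,262,4), (3,9,56,64,262,5), (1,10,56,68,262,5),
   (1,9,56,72,262,5), (1,16,46,54,267,3), (0,11,46,60,267,3), (0,13,46,64,267,3), (5,7,40,51,271,2),
   (6,11,40,60,270,2), (4,14,40,64,270,2), (4,13,52,60,272,4), (0,0,52,66,272,4), (1,3,52,70,272,4),
   (1,6,33,40,279,1), (0,12,33,51,278,1), (2,4,33,62,277,1), (1,17,47,55,279,3), (3,6,47,62,279,3),
   (3,10,47,70,278,3), (7,14,47,73,278,3), (0,6,41,47,285,2), (2,4,41,58,284,2), (10,19,41,59,284,2),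
   (1,7,63,67,284,6), (3,7,41,75,283,2), (2,5,63,79,283,6), (5,10,63,82,283,6), (0,7,63,86,283,6),
   (0,10,48,58,291,3), (2,9,48,63,291,3), (7,9,34,40,296,1), (1,2,34,54,295,1)]"

lemma certificate_table_valid: "certificates_from 11 certificate_table"
  unfolding certificate_table_def by (simp add: certificate_def tri_def)

lemma certificate_table_length: "length certificate_table = 289"
  unfolding certificate_table_def by simp

lemma certificates_from_nth:
  "certificates_from n rs \<Longrightarrow> i < length rs \<Longrightarrow> certificate (n + i) (rs ! i)"
proof (induction n rs arbitrary: i rule: certificates_from.induct)
  case (2 n r rs)
  then show ?case by (cases i) auto
qed simp

lemma small_certificate:
  assumes "11 \<le> n" "n < 300"
  shows "\<exists>r. certificate n r"
proof -
  have "n - 11 < length certificate_table" using assms by (simp add: certificate_table_length)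
  then have "certificate (11 + (n - 11)) (certificate_table ! (n - 11))"
    by (rule certificates_from_nth[OF certificate_table_valid])
  then have "certificate n (certificate_table ! (n - 11))" using assms by simp
  then show ?thesis by blast
qed

text \<open>
  The first weighing shows that coin \<open>4\<close> is not the heaviest, the second that it outweighs
  two coins together; so it weighs at most \<open>4\<close> and more than \<open>1 + 2\<close>.
\<close>

lemma two_weighings_suffice_5: "two_weighings_suffice 5"
proof (rule two_weighings_sufficeI[where ws = "[({4}, {5}), ({1, 2}, {4})]" and k = 4])
  fix \<sigma> assume \<sigma>: "\<sigma> permutes {1..(5::nat)}"
    and less: "\<And>L R. (L, R) \<in> set [({4}, {5}), ({1, 2}, {4})] \<Longrightarrow> \<Sum>L < \<Sum>R \<Longrightarrow> sum \<sigma> L < sum \<sigma> R"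
  have "tri 2 \<le> (\<Sum>i=1..2. \<sigma> i)" by (rule tri_le_sum_permutes[OF \<sigma>]) simp
  then have "3 \<le> \<sigma> 1 + \<sigma> 2" by (simp add: numeral_2_eq_2)
  moreover have "\<sigma> 4 < \<sigma> 5" "\<sigma> 1 + \<sigma> 2 < \<sigma> 4"
    using less[of "{4}" "{5}"] less[of "{1, 2}" "{4}"] by simp_all
  moreover have "\<sigma> 5 \<in> {1..5}" by (rule permutes_in_image[OF \<sigma>, THEN iffD2]) simp
  ultimately show "\<sigma> 4 = 4" by simp
qed (auto simp: weighings_def)

text \<open>
  A variant of lemma \<open>two_weighings\<close> with \<open>a = 0\<close>, \<open>b = 4\<close>, \<open>m = 5\<close>, \<open>c = d = 6\<close> and
  \<open>P = {7}\<close>: here \<open>tri a + tri b + tri c + tri d\<close> is two less than \<open>tri n + n\<close>, which is made up for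
  by the first weighing being strict, since it counts twice.
\<close>

lemma two_weighings_suffice_9: "two_weighings_suffice 9"
proof (rule two_weighings_sufficeI[where ws = "[({1..5}, {7, 9}), ({6, 7}, {5, 8})]" and k = 9])
  fix \<sigma> assume \<sigma>: "\<sigma> permutes {1..(9::nat)}"
    and eq: "\<And>L R. (L, R) \<in> set [({1..5}, {7, 9}), ({6, 7}, {5, 8})] \<Longrightarrow> \<Sum>L = \<Sum>R \<Longrightarrow> sum \<sigma> L = sum \<sigma> R"
    and less: "\<And>L R. (L, R) \<in> set [({1..5}, {7, 9}), ({6, 7}, {5, 8})] \<Longrightarrow> \<Sum>L < \<Sum>R \<Longrightarrow> sum \<sigma> L < sum \<sigma> R"
  have step: "sum \<sigma> {1..t + 1} = sum \<sigma> {1..t} + \<sigma> (t + 1)" for t by simp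
  have "sum \<sigma> {1..5} < \<sigma> 7 + \<sigma> 9"
    using less[of "{1..5}" "{7, 9}"] by (simp add: sum_eq_tri tri_def)
  moreover have "\<sigma> 6 + \<sigma> 7 = \<sigma> 5 + \<sigma> 8"
    using eq[of "{6, 7}" "{5, 8}"] by simp
  moreover have "sum \<sigma> {1..9} = tri 9" by (rule sum_permutes[OF \<sigma>])
  moreover have "tri 4 \<le> sum \<sigma> {1..4}" "tri 6 \<le> sum \<sigma> {1..6}"
    by (rule tri_le_sum_permutes[OF \<sigma>]; simp)+
  ultimately have "9 \<le> \<sigma> 9"
    using step[of 4] step[of 5] step[of 6] step[of 7] step[of 8] by (simp add: tri_def)
  then show "\<sigma> 9 = 9" using permutes_eq_top[OF \<sigma>] by simp
qed (auto simp: weighings_def)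

lemma two_weighings_suffice_1: "two_weighings_suffice 1"
proof (rule two_weighings_sufficeI[where ws = "[]" and k = 1])
  fix \<sigma> assume \<sigma>: "\<sigma> permutes {1..(1::nat)}"
  have "\<sigma> 1 \<in> {1..1}" by (rule permutes_in_image[OF \<sigma>, THEN iffD2]) simp
  then show "\<sigma> 1 = 1" by simp
qed auto

lemma two_weighings_suffice_upto_10:
  assumes "1 \<le> n" "n \<le> 10"
  shows "two_weighings_suffice n"
proof -
  have "n = 1 \<or> n = 2 \<or> n = 3 \<or> n = 4 \<or> n = 5 \<or> n = 6 \<or> n = 7 \<or> n = 8 \<or> n = 9 \<or> n = 10"
    using assms by arith
  moreover have "two_weighings_suffice 2" by (rule one_weighing[of 1]) (simp_all add: tri_def)
  moreover have "two_weighings_suffice 3" by (rule one_weighing[of 2]) (simp_all add: tri_def)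
  moreover have "two_weighings_suffice 4" by (rule one_weighing[of 2]) (simp_all add: tri_def)
  moreover have "two_weighings_suffice 6" by (rule one_weighing[of 3]) (simp_all add: tri_def)
  moreover have "two_weighings_suffice 7" by (rule one_weighing[of 3]) (simp_all add: tri_def)
  moreover have "two_weighings_suffice 8"
    by (rule certificate_imp_two_weighings_suffice[of _ 1 1 5 6 6 1]) (simp add: certificate_def tri_def)
  moreover have "two_weighings_suffice 10" by (rule one_weighing[of 4]) (simp_all add: tri_def)
  ultimately show ?thesis
    using two_weighings_suffice_1 two_weighings_suffice_5 two_weighings_suffice_9 by (elim disjE; simp only:)
qed

section \<open>The bound\<close>

theorem theorem5p1:
  fixes n :: nat
  assumes "n \<ge> 1"
  shows "baron n \<le> 2 \<and>
    (\<exists>ws. length ws \<le> 2 \<and> set ws \<subseteq> weighings n \<and> determines_some_coin n ws)"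
proof -
  have "two_weighings_suffice n"
  proof (cases "n \<le> 10")
    case True
    then show ?thesis using assms two_weighings_suffice_upto_10 by blast
  next
    case False
    then obtain r where "certificate n r"
      using small_certificate[of n] large_certificate[of n] by fastforce
    then show ?thesis using certificate_imp_two_weighings_suffice by (cases r) blast
  qed
  then obtain ws where ws: "length ws \<le> 2" "set ws \<subseteq> weighings n" "determines_some_coin n ws"
    unfolding two_weighings_suffice_def by blast
  then have "baron n \<le> length ws" unfolding baron_def by (intro Least_le) blast
  then show ?thesis using ws by auto
qed

end
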